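(* Let $A=A^\top\in\mathbb{R}^{3\times3}$ be such that $\bar A=\frac12(\mathrm{tr}(A)I-A)$ is positive definite. Consider the attitude kinematics $\dot R=R[\omega]_\times$ on $SO(3)$, with angular velocity $\omega(t)\in\mathbb{R}^3$, coupled with the attitude observer (with error-free measurements) $$\dot{\hat R}=\hat R[\omega]_\times-[\sigma]_\times\hat R,\qquad \sigma=-\psi(AR\hat R^\top),\qquad \hat R(0)\in SO(3),$$ and let $\tilde R=R\hat R^\top$ be the attitude estimation error. Then: (1) The closed-loop system (for the error $\tilde R$) has at least four equilibria, and its equilibria are characterized by $\tilde R\in\{I\}\cup\mathcal{R}_a(\pi,\mathcal{E}(A))$, where $\mathcal{E}(A)$ is the set of all unit eigenvectors of $A$ and $\mathcal{R}_a(\pi,\mathcal{E}(A))=\{\mathcal{R}_a(\pi,v): v\in\mathcal{E}(A)\}$. (2) The set of all rotations of angle $\pi$, $\Pi=\{\tilde R\in SO(3): |\tilde R|_I=1\}$, is invariant and non-attractive. (3) For any $\tilde R(0)\in SO(3)\setminus\Pi$, one has $$\tilde R(t)=\mathcal{R}_r\big(e^{-\bar At}\mathcal{Z}(\tilde R(0))\big),\qquad \forall t\ge0.$$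
   Context: $SO(3)=\{R\in\mathbb{R}^{3\times3}: \det R=1,\ RR^\top=I\}$. $[x]_\times$ is the skew-symmetric matrix with $[x]_\times y=x\times y$ for $x,y\in\mathbb{R}^3$; $\mathrm{vex}$ is the inverse of $x\mapsto[x]_\times$ on skew-symmetric matrices. For $M\in\mathbb{R}^{3\times3}$, $\psi(M)=\mathrm{vex}\big((M-M^\top)/2\big)$. For $R\in SO(3)$, $|R|_I\in[0,1]$ is defined by $|R|_I^2=\frac14\mathrm{tr}(I-R)$. Angle-axis map: $\mathcal{R}_a(\theta,u)=I+\sin(\theta)[u]_\times+(1-\cos\theta)[u]_\times^2$ for $\theta\in\mathbb{R}$ and unit $u\in\mathbb{R}^3$. Cayley map: $\mathcal{R}_r(z)=(I+[z]_\times)(I-[z]_\times)^{-1}$ for $z\in\mathbb{R}^3$; it is a diffeomorphism from $\mathbb{R}^3$ onto $SO(3)\setminus\Pi$ with inverse $\mathcal{Z}(R)=\mathrm{vex}\big((R-I)(R+I)^{-1}\big)=\frac{\psi(R)}{2(1-|R|_I^2)}$ (the vector of Rodrigues parameters). "Non-attractive" means that $\Pi$ is a repeller: error trajectories starting outside $\Pi$ neither reach nor converge to $\Pi$. *)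

theory Defs
  imports "HOL-Analysis.Analysis"
begin

definition SO3 :: "(real^3^3) set" where
  "SO3 = {R. det R = 1 \<and> R ** transpose R = mat 1}"

definition skew :: "real^3 \<Rightarrow> real^3^3" where
  "skew x = matrix (cross3 x)"

(* Inverse of skew on its range, the skew-symmetric matrices (see skew_vex below);
   unspecified on other matrices. *)
definition vex :: "real^3^3 \<Rightarrow> real^3" where
  "vex = inv_into UNIV skew"

definition psi :: "real^3^3 \<Rightarrow> real^3" where
  "psi M = vex ((1/2) *\<^sub>R (M - transpose M))"

definition att_norm :: "real^3^3 \<Rightarrow> real" where
  "att_norm R = sqrt (trace (mat 1 - R) / 4)"

definition half_turns :: "(real^3^3) set" where
  "half_turns = {R \<in> SO3. att_norm R = 1}"

definition angle_axis :: "real \<Rightarrow> real^3 \<Rightarrow> real^3^3" where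
  "angle_axis \<theta> u = mat 1 + sin \<theta> *\<^sub>R skew u + (1 - cos \<theta>) *\<^sub>R (skew u ** skew u)"

definition cayley :: "real^3 \<Rightarrow> real^3^3" where
  "cayley z = (mat 1 + skew z) ** matrix_inv (mat 1 - skew z)"

(* The inverse of cayley on the rotations outside half_turns; there R + I is invertible. *)
definition rodrigues :: "real^3^3 \<Rightarrow> real^3" where
  "rodrigues R = vex ((R - mat 1) ** matrix_inv (R + mat 1))"

lemma skew_mult_vec: "skew x *v y = cross3 x y"
  by (simp add: skew_def matrix_def matrix_vector_mult_def vec_eq_iff forall_3 sum_3
      cross3_def axis_def algebra_simps)

lemma inj_skew: "inj skew"
proof (rule injI)
  fix x y :: "real^3" assume "skew x = skew y"
  then have "cross3 x v = cross3 y v" for v by (metis skew_mult_vec)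
  from this[of "axis 1 1"] this[of "axis 2 1"] show "x = y"
    by (auto simp: cross3_simps axis_def forall_3)
qed

lemma vex_skew [simp]: "vex (skew x) = x"
  by (simp add: vex_def inj_skew inv_f_f)

lemma skew_vex:
  assumes "transpose M = - M"
  shows "skew (vex M) = M"
proof -
  have e: "M $ i $ j = - M $ j $ i" for i j
    using arg_cong[OF assms, of "\<lambda>N. N $ j $ i"] by (simp add: transpose_def)
  have d: "M $ i $ i = 0" for i
    using e[of i i] by simp
  have "skew (vector [M $ 3 $ 2, M $ 1 $ 3, M $ 2 $ 1]) = M"
    using e[of 1 2] e[of 1 3] e[of 2 3] d
    by (simp add: skew_def matrix_def cross3_def axis_def vec_eq_iff forall_3)
  then show ?thesis by (metis vex_skew)
qed

definition unit_eigenvectors :: "real^3^3 \<Rightarrow> (real^3) set" where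
  "unit_eigenvectors A = {v. norm v = 1 \<and> (\<exists>c. A *v v = c *\<^sub>R v)}"

definition pos_def :: "real^3^3 \<Rightarrow> bool" where
  "pos_def M \<longleftrightarrow> transpose M = M \<and> (\<forall>x. x \<noteq> 0 \<longrightarrow> 0 < x \<bullet> (M *v x))"

definition bar :: "real^3^3 \<Rightarrow> real^3^3" where
  "bar A = (1/2) *\<^sub>R (trace A *\<^sub>R mat 1 - A)"

(* The multiplication and power operations of the vector type are componentwise, so exp is
   not available for matrices and the matrix powers are iterates of **. *)
definition matrix_exp :: "real^3^3 \<Rightarrow> real^3^3" where
  "matrix_exp M = (\<Sum>n. (1 / fact n) *\<^sub>R (((**) M ^^ n) (mat 1)))"

(* Time ranges over [0, infinity); derivatives at 0 are one-sided. *)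

definition attitude_kinematics :: "(real \<Rightarrow> real^3) \<Rightarrow> (real \<Rightarrow> real^3^3) \<Rightarrow> bool" where
  "attitude_kinematics \<omega> R \<longleftrightarrow>
     (\<forall>t\<ge>0. R t \<in> SO3 \<and>
        (R has_vector_derivative R t ** skew (\<omega> t)) (at t within {0..}))"

definition innovation :: "real^3^3 \<Rightarrow> real^3^3 \<Rightarrow> real^3^3 \<Rightarrow> real^3" where
  "innovation A R Rh = - psi (A ** R ** transpose Rh)"

(* The estimate lies in SO3 initially; at later times this is a consequence of the dynamics. *)
definition attitude_observer ::
  "real^3^3 \<Rightarrow> (real \<Rightarrow> real^3) \<Rightarrow> (real \<Rightarrow> real^3^3) \<Rightarrow> (real \<Rightarrow> real^3^3) \<Rightarrow> bool" where
  "attitude_observer A \<omega> R Rh \<longleftrightarrow>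
     Rh 0 \<in> SO3 \<and>
     (\<forall>t\<ge>0. (Rh has_vector_derivative
         Rh t ** skew (\<omega> t) - skew (innovation A (R t) (Rh t)) ** Rh t) (at t within {0..}))"

(* The error trajectories of the closed loop driven by a given attitude motion R; every
   initial error arises from exactly one initial estimate. *)
definition error_trajectories ::
  "real^3^3 \<Rightarrow> (real \<Rightarrow> real^3) \<Rightarrow> (real \<Rightarrow> real^3^3) \<Rightarrow> (real \<Rightarrow> real^3^3) set" where
  "error_trajectories A \<omega> R =
     {X. \<exists>Rh. attitude_observer A \<omega> R Rh \<and> (\<forall>t\<ge>0. X t = R t ** transpose (Rh t))}"

definition equilibria :: "(real \<Rightarrow> 'a) set \<Rightarrow> 'a set" where
  "equilibria T = {x. (\<lambda>t. x) \<in> T}"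

definition invariant_set :: "(real \<Rightarrow> 'a) set \<Rightarrow> 'a set \<Rightarrow> bool" where
  "invariant_set T S \<longleftrightarrow> (\<forall>X\<in>T. X 0 \<in> S \<longrightarrow> (\<forall>t\<ge>0. X t \<in> S))"

definition non_attractive :: "(real \<Rightarrow> 'a::metric_space) set \<Rightarrow> 'a set \<Rightarrow> bool" where
  "non_attractive T S \<longleftrightarrow>
     (\<forall>X\<in>T. X 0 \<notin> S \<longrightarrow>
        (\<forall>t\<ge>0. X t \<notin> S) \<and> \<not> ((\<lambda>t. infdist (X t) S) \<longlongrightarrow> 0) at_top)"

end

theory Submission
  imports Defs
begin

text \<open>
  The angular velocity cancels from the error: along the closed loop the error
  \<open>X = R ** transpose Rh\<close> obeys the autonomous equation \<open>X' = - X ** skew (psi (A ** X))\<close>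
  (\<open>error_trajectories_ode\<close>). For this \<open>Rh\<close> has to stay a rotation, which holds because
  \<open>Rh ** transpose Rh\<close> evolves by commutators with skew matrices, and these preserve the
  Frobenius distance to the identity.

  Everything is then read off in the unit quaternion \<open>(\<eta>, \<epsilon>)\<close> of \<open>X\<close>, which exists for every
  rotation (\<open>SO3_quat_rot\<close>). There \<open>1 + trace X = 4 * \<eta>\<^sup>2\<close>, so the half turns are \<open>\<eta> = 0\<close>, and
  \<open>psi (A ** X) = 2 \<eta> bar A \<epsilon> + \<epsilon> \<times> A \<epsilon>\<close> (\<open>psi_mult_quat_rot\<close>).

  Equilibria are the rotations with \<open>psi (A ** X) = 0\<close>. The inner product of this equation with
  \<open>\<epsilon>\<close> leaves \<open>2 \<eta> (\<epsilon> \<bullet> bar A \<epsilon>) = 0\<close>, and positivity of \<open>bar A\<close> gives \<open>\<epsilon> = 0\<close>, the identity, or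
  \<open>\<eta> = 0\<close>, and then \<open>\<epsilon> \<times> A \<epsilon> = 0\<close> says that \<open>\<epsilon>\<close> is an eigenvector
  (\<open>psi_mult_eq_0_iff\<close>). An orthonormal eigenbasis of \<open>A\<close> supplies three different half turns
  (\<open>four_critical_rotations\<close>).

  The function \<open>g = 1 + trace X\<close> satisfies \<open>g' = 2 g (\<epsilon> \<bullet> bar A \<epsilon>)\<close>, hence \<open>0 \<le> g' \<le> K g\<close>. The
  upper bound keeps \<open>g\<close> at \<open>0\<close> if it starts there, so half turns stay half turns. The lower bound
  makes \<open>g\<close> nondecreasing, and since \<open>g\<close> is at most a multiple of the distance to the half turns,
  a trajectory that starts off them stays at a positive distance.

  Off the half turns the Rodrigues vector \<open>z = \<epsilon> / \<eta> = 2 psi X / g\<close> is a differentiable function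
  of time. Differentiating the Cayley relation \<open>(I - [z]) X = I + [z]\<close> gives the linear equation
  \<open>z' = - bar A z\<close> (\<open>rodrigues_ode\<close>), whose solution is the matrix exponential: the
  difference of two solutions has nonincreasing norm (\<open>linear_ode_solution\<close>).
\<close>

section \<open>Linear algebra of 3 by 3 matrices\<close>

lemma bounded_bilinear_matrix_mult:
  "bounded_bilinear ((**) :: real^'n^'m \<Rightarrow> real^'p^'n \<Rightarrow> real^'p^'m)"
  unfolding bilinear_conv_bounded_bilinear[symmetric] bilinear_def
  by (auto intro!: linearI simp: sum.distrib algebra_simps
      matrix_matrix_mult_def vec_eq_iff sum_distrib_left)

interpretation matrix_mult: bounded_bilinear
  "(**) :: real^'n^'m \<Rightarrow> real^'p^'n \<Rightarrow> real^'p^'m"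
  by (rule bounded_bilinear_matrix_mult)

lemma bounded_bilinear_matrix_vector_mult:
  "bounded_bilinear ((*v) :: real^'n^'m \<Rightarrow> real^'n \<Rightarrow> real^'m)"
  unfolding bilinear_conv_bounded_bilinear[symmetric] bilinear_def
  by (auto intro!: linearI simp: matrix_vector_mult_def vec_eq_iff sum_distrib_left
      sum.distrib algebra_simps)

interpretation matrix_vector_mult: bounded_bilinear
  "(*v) :: real^'n^'m \<Rightarrow> real^'n \<Rightarrow> real^'m"
  by (rule bounded_bilinear_matrix_vector_mult)

lemma skew_entries [simp]:
  "skew x $ 1 $ 1 = 0" "skew x $ 1 $ 2 = - x $ 3" "skew x $ 1 $ 3 = x $ 2"
  "skew x $ 2 $ 1 = x $ 3" "skew x $ 2 $ 2 = 0" "skew x $ 2 $ 3 = - x $ 1"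
  "skew x $ 3 $ 1 = - x $ 2" "skew x $ 3 $ 2 = x $ 1" "skew x $ 3 $ 3 = 0"
  by (simp_all add: skew_def matrix_def cross3_def axis_def)

lemma bounded_linear_skew: "bounded_linear skew"
  by (auto intro!: linearI simp: linear_conv_bounded_linear[symmetric] vec_eq_iff forall_3)

lemmas skew_linear = bounded_linear.linear[OF bounded_linear_skew]
lemmas skew_add = linear_add[OF skew_linear]
lemmas skew_diff = linear_diff[OF skew_linear]
lemmas skew_minus = linear_neg[OF skew_linear]
lemmas skew_scaleR = linear_scale[OF skew_linear]
lemmas skew_zero = linear_0[OF skew_linear]

lemma transpose_skew [simp]: "transpose (skew x) = - skew x"
  by (simp add: transpose_def vec_eq_iff forall_3)

lemma psi_eq:
  "psi M = vector [(M $ 3 $ 2 - M $ 2 $ 3) / 2, (M $ 1 $ 3 - M $ 3 $ 1) / 2, (M $ 2 $ 1 - M $ 1 $ 2) / 2]"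
  (is "_ = ?v")
proof -
  have "(1/2) *\<^sub>R (M - transpose M) = skew ?v"
    by (simp add: vec_eq_iff forall_3 transpose_def field_simps)
  then show ?thesis by (simp add: psi_def)
qed

lemma bounded_linear_psi: "bounded_linear psi"
  by (auto intro!: linearI simp: linear_conv_bounded_linear[symmetric] psi_eq vec_eq_iff forall_3 field_simps)

lemma bounded_linear_trace: "bounded_linear (trace :: real^'n^'n \<Rightarrow> real)"
  by (auto intro!: linearI simp: linear_conv_bounded_linear[symmetric] trace_def sum.distrib sum_distrib_left)

lemmas trace_linear = bounded_linear.linear[OF bounded_linear_trace]

lemma bounded_linear_transpose: "bounded_linear (transpose :: real^'n^'m \<Rightarrow> real^'m^'n)"
  by (auto intro!: linearI simp: linear_conv_bounded_linear[symmetric] transpose_def vec_eq_iff)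

lemmas transpose_linear = bounded_linear.linear[OF bounded_linear_transpose]
lemmas transpose_add = linear_add[OF transpose_linear]
lemmas transpose_diff = linear_diff[OF transpose_linear]

lemmas mat3_simps = vec_eq_iff forall_3 matrix_matrix_mult_def matrix_vector_mult_def
  mat_def sum_3 trace_def transpose_def inner_vec_def cross3_def

section \<open>Rotations as unit quaternions\<close>

text \<open>
  The Euler--Rodrigues formula for the rotation of the unit quaternion with scalar part \<open>\<eta>\<close> and
  vector part \<open>\<epsilon>\<close>. It covers the half turns (\<open>\<eta> = 0\<close>) and the image of the Cayley map (\<open>\<eta> \<noteq> 0\<close>) by one
  polynomial expression.
\<close>

definition quat_rot :: "real \<Rightarrow> real^3 \<Rightarrow> real^3^3" where
  "quat_rot \<eta> \<epsilon> = mat 1 + (2 * \<eta>) *\<^sub>R skew \<epsilon> + 2 *\<^sub>R (skew \<epsilon> ** skew \<epsilon>)"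

lemma quat_rot_vec: "quat_rot \<eta> \<epsilon> *v x = x + (2 * \<eta>) *\<^sub>R cross3 \<epsilon> x + 2 *\<^sub>R cross3 \<epsilon> (cross3 \<epsilon> x)"
  by (simp add: quat_rot_def matrix_vector_mult.add_left matrix_vector_mult.scaleR_left
      skew_mult_vec flip: matrix_vector_mul_assoc)

text \<open>
  The two terms come from \<open>A [\<epsilon>] + [\<epsilon>] A = [(trace A I - A) \<epsilon>]\<close> and
  \<open>A [\<epsilon>]\<^sup>2 - [\<epsilon>]\<^sup>2 A = [\<epsilon> \<times> A \<epsilon>]\<close>; the first of them is the reason why \<open>bar A\<close> governs the error.
\<close>

lemma psi_mult_quat_rot:
  assumes "transpose A = A"
  shows "psi (A ** quat_rot \<eta> \<epsilon>) = (2 * \<eta>) *\<^sub>R (bar A *v \<epsilon>) + cross3 \<epsilon> (A *v \<epsilon>)"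
proof -
  have "A $ i $ j = A $ j $ i" for i j
    using arg_cong[OF assms, of "\<lambda>N. N $ j $ i"] by (simp add: transpose_def)
  from this[of 2 1] this[of 3 1] this[of 3 2] show ?thesis
    by (simp add: psi_eq quat_rot_def bar_def mat3_simps field_simps)
qed

lemma psi_quat_rot: "psi (quat_rot \<eta> \<epsilon>) = (2 * \<eta>) *\<^sub>R \<epsilon>"
  by (simp add: psi_eq quat_rot_def mat3_simps field_simps)

lemma trace_quat_rot:
  assumes "\<eta>\<^sup>2 + \<epsilon> \<bullet> \<epsilon> = 1"
  shows "1 + trace (quat_rot \<eta> \<epsilon>) = 4 * \<eta>\<^sup>2"
  using assms by (simp add: quat_rot_def mat3_simps field_simps)

lemma trace_mult_skew: "trace (M ** skew v) = - 2 * (psi M \<bullet> v)"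
  by (simp add: psi_eq mat3_simps field_simps)

text \<open>
  With \<open>\<epsilon> = \<eta> z\<close> the rotation is \<open>I + 2 \<eta>\<^sup>2 ([z] + [z]\<^sup>2)\<close>, and \<open>[z]\<^sup>3 = - (z \<bullet> z) [z]\<close> turns the product
  with \<open>I - [z]\<close> into \<open>I + [z]\<close>. This form of the Cayley map needs no inverse matrix.
\<close>

lemma quat_rot_cayley_relation:
  assumes "\<eta>\<^sup>2 * (1 + z \<bullet> z) = 1"
  shows "(mat 1 - skew z) ** quat_rot \<eta> (\<eta> *\<^sub>R z) = mat 1 + skew z"
   and "quat_rot \<eta> (\<eta> *\<^sub>R z) ** (mat 1 - skew z) = mat 1 + skew z"
proof -
  have cube: "skew z ** (skew z ** skew z) = - (z \<bullet> z) *\<^sub>R skew z"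
    by (simp add: mat3_simps field_simps)
  have e: "quat_rot \<eta> (\<eta> *\<^sub>R z) = mat 1 + (2 * \<eta>\<^sup>2) *\<^sub>R (skew z + skew z ** skew z)"
    by (simp add: quat_rot_def skew_scaleR matrix_mult.scaleR_left matrix_mult.scaleR_right
        power2_eq_square scaleR_add_right mult_ac)
  have "(2 * \<eta>\<^sup>2) *\<^sub>R ((1 + z \<bullet> z) *\<^sub>R skew z) = 2 *\<^sub>R skew z"
    using assms by (simp add: mult.assoc)
  then have f: "(2 * \<eta>\<^sup>2) *\<^sub>R skew z + (2 * \<eta>\<^sup>2) *\<^sub>R ((z \<bullet> z) *\<^sub>R skew z) = skew z + skew z"
    by (simp add: scaleR_add_left scaleR_add_right scaleR_2)
  show "(mat 1 - skew z) ** quat_rot \<eta> (\<eta> *\<^sub>R z) = mat 1 + skew z"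
    using f unfolding e
    by (simp add: matrix_mult.add_left matrix_mult.add_right matrix_mult.diff_left matrix_mult.diff_right
       matrix_mult.scaleR_left matrix_mult.scaleR_right cube scaleR_add_right algebra_simps
       flip: scaleR_scaleR)
  show "quat_rot \<eta> (\<eta> *\<^sub>R z) ** (mat 1 - skew z) = mat 1 + skew z"
    using f unfolding e
    by (simp add: matrix_mult.add_left matrix_mult.add_right matrix_mult.diff_left matrix_mult.diff_right
       matrix_mult.scaleR_left matrix_mult.scaleR_right cube scaleR_add_right algebra_simps 
       matrix_mul_assoc[symmetric] flip: scaleR_scaleR)
qed

text \<open>
  This congruence appears when the Cayley relation is differentiated in time. The commutator of
  \<open>[z]\<close> and \<open>[v]\<close> is \<open>[z \<times> v]\<close>, and \<open>[z] [v] [z] = - (z \<bullet> v) [z]\<close>.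
\<close>

lemma skew_sandwich:
  "(mat 1 + skew z) ** skew v ** (mat 1 - skew z) = skew (v + cross3 z v + (z \<bullet> v) *\<^sub>R z)"
  by (simp add: mat3_simps algebra_simps)

text \<open>
  This cancellation makes the dynamics of the Rodrigues vector linear: since
  \<open>A = trace A I - 2 bar A\<close>, the terms with \<open>z \<times> A z\<close> drop out and those of third order
  in \<open>z\<close> combine to a multiple of \<open>bar A z\<close>.
\<close>

lemma rodrigues_rhs:
  assumes "v = 2 *\<^sub>R (bar A *v z) + cross3 z (A *v z)"
  shows "v + cross3 z v + (z \<bullet> v) *\<^sub>R z = (2 * (1 + z \<bullet> z)) *\<^sub>R (bar A *v z)"
  unfolding assms by (simp add: bar_def mat3_simps field_simps)

lemma SO3_inner:
  assumes "X \<in> SO3"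
  shows "(X *v x) \<bullet> (X *v y) = x \<bullet> y"
proof -
  have "transpose X ** X = mat 1"
    using assms by (simp add: SO3_def matrix_left_right_inverse)
  then show ?thesis
    by (metis dot_lmul_matrix matrix_vector_mul_assoc matrix_vector_mul_lid transpose_matrix_vector)
qed

lemma SO3_cross:
  assumes "X \<in> SO3"
  shows "cross3 (X *v x) (X *v y) = X *v cross3 x y"
  using assms
  by (intro cross_rotation_matrix)
     (simp add: SO3_def orthogonal_matrix_def matrix_left_right_inverse rotation_matrix_def)

lemma orthonormal_cross:
  fixes u v :: "real^3"
  assumes "u \<bullet> u = 1" "v \<bullet> v = 1" "u \<bullet> v = 0"
  shows "cross3 u v \<bullet> u = 0" "cross3 u v \<bullet> v = 0" "cross3 u v \<bullet> cross3 u v = 1"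
  using norm_cross_dot[of u v] assms
  by (simp_all add: dot_cross_self power_mult_distrib power2_norm_eq_inner)

text \<open>
  The remainder \<open>d\<close> of the expansion is orthogonal to \<open>u\<close>, \<open>v\<close> and \<open>u \<times> v\<close>; then
  \<open>(u \<times> v) \<times> d\<close> also vanishes by the triple product formula, which leaves \<open>d = 0\<close>.
\<close>

lemma orthonormal_frame_expansion:
  fixes u v x :: "real^3"
  assumes "u \<bullet> u = 1" "v \<bullet> v = 1" "u \<bullet> v = 0"
  shows "x = (x \<bullet> u) *\<^sub>R u + (x \<bullet> v) *\<^sub>R v + (x \<bullet> cross3 u v) *\<^sub>R cross3 u v"
proof -
  define w where "w = cross3 u v"
  have w: "w \<bullet> u = 0" "w \<bullet> v = 0" "w \<bullet> w = 1"
    using orthonormal_cross[OF assms] by (simp_all add: w_def)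
  define d where "d = x - ((x \<bullet> u) *\<^sub>R u + (x \<bullet> v) *\<^sub>R v + (x \<bullet> w) *\<^sub>R w)"
  have d: "d \<bullet> u = 0" "d \<bullet> v = 0" "w \<bullet> d = 0"
    using assms w by (simp_all add: d_def inner_diff_left inner_diff_right inner_add_left
        inner_add_right inner_commute)
  have "cross3 w d = (u \<bullet> d) *\<^sub>R v - (v \<bullet> d) *\<^sub>R u"
    by (simp add: w_def cross3_simps forall_3)
  then have "cross3 w d = 0" using d by (simp add: inner_commute)
  then have "d = 0"
    using d w norm_and_cross_eq_0[of w d] by auto
  then show ?thesis by (simp add: d_def w_def)
qed

text \<open>
  Euler's rotation theorem: \<open>X - I = - X ** transpose (X - I)\<close> forces
  \<open>det (X - I) = - det (X - I)\<close> in odd dimension, so \<open>1\<close> is an eigenvalue.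
\<close>

lemma SO3_fixed_axis:
  assumes "X \<in> SO3"
  obtains u where "norm u = 1" "X *v u = u"
proof -
  have det: "det X = 1" and orth: "X ** transpose X = mat 1"
    using assms by (simp_all add: SO3_def)
  have neg: "det (- M) = - det M" for M :: "real^3^3"
    by (simp add: det_3)
  have "X - mat 1 = X ** (- transpose (X - mat 1))"
    by (simp add: transpose_diff matrix_mult.diff_right matrix_mult.minus_right orth)
  then have "det (X - mat 1) = det X * - det (X - mat 1)"
    by (metis det_mul neg det_transpose)
  then have "det (X - mat 1) = 0" using det by simp
  then obtain x where x: "x \<noteq> 0" "(X - mat 1) *v x = 0"
    by (metis invertible_det_nz invertible_left_inverse matrix_left_invertible_ker)
  then have "X *v x = x" by (simp add: matrix_vector_mult.diff_left)
  then have "X *v (x /\<^sub>R norm x) = x /\<^sub>R norm x"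
    by (simp add: matrix_vector_mult.scaleR_right)
  then show ?thesis using x(1) by (intro that[of "x /\<^sub>R norm x"]) auto
qed

lemma unit_orthogonal_vector:
  fixes u :: "real^3"
  obtains v where "norm v = 1" "u \<bullet> v = 0"
proof -
  obtain x where x: "x \<noteq> 0" "orthogonal u x"
    using orthogonal_to_vector_exists[of u] by (auto simp: orthogonal_commute)
  then show ?thesis
    by (intro that[of "x /\<^sub>R norm x"]) (auto simp: orthogonal_def)
qed

text \<open>
  On the plane orthogonal to the fixed axis the rotation acts by \<open>v \<mapsto> c v + s w\<close>, \<open>w \<mapsto> c w - s v\<close>, as it
  preserves inner and cross products. The quaternion is made from the half angle.
\<close>

lemma SO3_quat_rot:
  assumes "X \<in> SO3"
  obtains \<eta> \<epsilon> where "\<eta>\<^sup>2 + \<epsilon> \<bullet> \<epsilon> = 1" "X = quat_rot \<eta> \<epsilon>"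
proof -
  obtain u where u: "norm u = 1" "X *v u = u" using SO3_fixed_axis[OF assms] .
  obtain v where v: "norm v = 1" "u \<bullet> v = 0" using unit_orthogonal_vector .
  define w where "w = cross3 u v"
  define c s where "c = (X *v v) \<bullet> v" and "s = (X *v v) \<bullet> w"
  have uu: "u \<bullet> u = 1" and vv: "v \<bullet> v = 1" using u v by (simp_all add: dot_square_norm)
  have w: "w \<bullet> u = 0" "w \<bullet> v = 0" "w \<bullet> w = 1"
    using orthonormal_cross[OF uu vv v(2)] by (simp_all add: w_def)
  have uw: "cross3 u w = - v"
  proof -
    have "cross3 u w = (u \<bullet> v) *\<^sub>R u - (u \<bullet> u) *\<^sub>R v"
      by (simp add: w_def cross3_simps forall_3)
    then show ?thesis using uu v by simp
  qed
  have Xv_u: "(X *v v) \<bullet> u = 0"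
    using SO3_inner[OF assms, of v u] u v by (simp add: inner_commute)
  have Xv: "X *v v = c *\<^sub>R v + s *\<^sub>R w"
    using orthonormal_frame_expansion[OF uu vv v(2), of "X *v v"] Xv_u
    by (simp add: c_def s_def w_def)
  have Xw: "X *v w = c *\<^sub>R w - s *\<^sub>R v"
    using SO3_cross[OF assms, of u v] u Xv uw
    by (simp add: w_def[symmetric] cross_add_right cross_mult_right)
  have "c\<^sup>2 + s\<^sup>2 = 1"
    using SO3_inner[OF assms, of v v] vv w unfolding Xv
    by (simp add: inner_add_left inner_add_right inner_commute power2_eq_square)
  then obtain t where t: "c = cos t" "s = sin t" by (metis sincos_total_2pi)
  define \<eta> e where "\<eta> = cos (t / 2)" and "e = sin (t / 2)"
  have ce: "c = 1 - 2 * e\<^sup>2" and se: "s = 2 * \<eta> * e"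
    using cos_double_sin[of "t/2"] sin_double[of "t/2"] by (simp_all add: t \<eta>_def e_def)
  let ?Q = "quat_rot \<eta> (e *\<^sub>R u)"
  have "(X - ?Q) *v x = 0" for x
  proof -
    have Qu: "(X - ?Q) *v u = 0"
      by (simp add: matrix_vector_mult.diff_left quat_rot_vec cross_mult_left u)
    have Qv: "(X - ?Q) *v v = 0"
      by (simp add: matrix_vector_mult.diff_left quat_rot_vec cross_mult_left cross_mult_right
          w_def[symmetric] uw Xv ce se algebra_simps power2_eq_square)
    have Qw: "(X - ?Q) *v w = 0"
      by (simp add: matrix_vector_mult.diff_left quat_rot_vec cross_mult_left cross_mult_right
          w_def[symmetric] uw Xw ce se algebra_simps power2_eq_square)
    have "x = (x \<bullet> u) *\<^sub>R u + (x \<bullet> v) *\<^sub>R v + (x \<bullet> w) *\<^sub>R w"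
      using orthonormal_frame_expansion[OF uu vv v(2)] by (simp add: w_def)
    then have "(X - ?Q) *v x = (X - ?Q) *v ((x \<bullet> u) *\<^sub>R u + (x \<bullet> v) *\<^sub>R v + (x \<bullet> w) *\<^sub>R w)"
      by simp
    then show ?thesis
      by (simp add: matrix_vector_mult.add_right matrix_vector_mult.scaleR_right Qu Qv Qw)
  qed
  then have "X - ?Q = 0"
    unfolding matrix_eq by simp
  moreover have "\<eta>\<^sup>2 + (e *\<^sub>R u) \<bullet> (e *\<^sub>R u) = 1"
    by (simp add: uu \<eta>_def e_def power2_eq_square[symmetric])
  ultimately show ?thesis by (intro that[of \<eta> "e *\<^sub>R u"]) simp_all
qed

lemma half_turns_eq: "half_turns = {X \<in> SO3. 1 + trace X = 0}"
  by (auto simp: half_turns_def att_norm_def trace_sub trace_I)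

text \<open>
  The half turn about \<open>v\<close> fixes \<open>v\<close> and reverses the orthogonal plane.
\<close>

lemma half_turn_vec:
  assumes "norm v = 1"
  shows "quat_rot 0 v *v x = (2 * (v \<bullet> x)) *\<^sub>R v - x"
proof -
  have "cross3 v (cross3 v x) = (v \<bullet> x) *\<^sub>R v - (v \<bullet> v) *\<^sub>R x"
    by (simp add: cross3_simps forall_3)
  then show ?thesis
    using assms by (simp add: quat_rot_vec dot_square_norm scaleR_diff_right scaleR_2)
qed

lemma half_turn_in_SO3:
  assumes "norm v = 1"
  shows "quat_rot 0 v \<in> SO3"
proof -
  have vv: "v \<bullet> v = 1" using assms by (simp add: dot_square_norm)
  \<comment> \<open>With the square of the skew matrix expanded the determinant is a polynomial in the norm of \<open>v\<close>.\<close>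
  have q: "quat_rot 0 v = (1 - 2 * (v \<bullet> v)) *\<^sub>R mat 1 + 2 *\<^sub>R (\<chi> i j. v $ i * v $ j)"
    by (simp add: quat_rot_def mat3_simps algebra_simps)
  have "transpose (quat_rot 0 v) = quat_rot 0 v"
    by (simp add: q vec_eq_iff transpose_def mat_def mult.commute)
  moreover have "quat_rot 0 v ** quat_rot 0 v = mat 1"
    unfolding matrix_eq
    by (simp add: half_turn_vec[OF assms] inner_diff_right vv flip: matrix_vector_mul_assoc)
  moreover have "det (quat_rot 0 v) = (1 - 2 * (v \<bullet> v))\<^sup>2"
    unfolding q by (simp add: det_3 mat_def inner_vec_def sum_3 power2_eq_square algebra_simps)
  ultimately show ?thesis using vv by (simp add: SO3_def)
qed

lemma matrix_inv_eqI:
  fixes A B :: "real^'n^'n"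
  assumes "A ** B = mat 1"
  shows "matrix_inv A = B"
proof -
  have BA: "B ** A = mat 1" using assms by (simp add: matrix_left_right_inverse)
  have "A ** matrix_inv A = mat 1 \<and> matrix_inv A ** A = mat 1"
    unfolding matrix_inv_def by (rule someI[of _ B]) (use assms BA in simp)
  then show ?thesis
    by (metis BA matrix_mul_assoc matrix_mul_lid matrix_mul_rid)
qed

text \<open>
  Adding \<open>I - [z]\<close> to the relation \<open>X (I - [z]) = I + [z]\<close> gives \<open>(X + I) (I - [z]) = 2 I\<close>, which identifies
  the inverses in both definitions.
\<close>

lemma cayley_rodrigues_quat_rot:
  assumes "\<eta>\<^sup>2 * (1 + z \<bullet> z) = 1"
  shows "cayley z = quat_rot \<eta> (\<eta> *\<^sub>R z)"
    and "rodrigues (quat_rot \<eta> (\<eta> *\<^sub>R z)) = z"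
proof -
  define X where "X = quat_rot \<eta> (\<eta> *\<^sub>R z)"
  note L = quat_rot_cayley_relation(1)[OF assms, folded X_def]
  note R = quat_rot_cayley_relation(2)[OF assms, folded X_def]
  let ?M = "mat 1 - skew z"
  have inv_left: "(1/2) *\<^sub>R ((X + mat 1) ** ?M) = mat 1"
    using R by (simp add: matrix_mult.add_left scaleR_add_left[symmetric] scaleR_2[symmetric]
      algebra_simps)
  then have i1: "((1/2) *\<^sub>R (X + mat 1)) ** ?M = mat 1"
    by (simp add: matrix_mult.scaleR_left)
  then have i2: "?M ** ((1/2) *\<^sub>R (X + mat 1)) = mat 1"
    by (simp add: matrix_left_right_inverse)
  have "matrix_inv ?M = (1/2) *\<^sub>R (X + mat 1)"
    using matrix_inv_eqI[OF i2] .
  then have "?M ** matrix_inv ?M = mat 1" using i2 by simp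
  then show "cayley z = quat_rot \<eta> (\<eta> *\<^sub>R z)"
    unfolding cayley_def X_def[symmetric] R[symmetric]
    by (simp add: matrix_mul_assoc[symmetric])
  have j1: "(X + mat 1) ** ((1/2) *\<^sub>R ?M) = mat 1" 
    using i1 by (simp add: matrix_mult.scaleR_left matrix_mult.scaleR_right)
  have "matrix_inv (X + mat 1) = (1/2) *\<^sub>R ?M"
    using matrix_inv_eqI[OF j1] .
  moreover have "(X - mat 1) ** ((1/2) *\<^sub>R ?M) = skew z"
    using R by (simp add: matrix_mult.scaleR_right matrix_mult.diff_left
      scaleR_2[symmetric])
  ultimately show "rodrigues (quat_rot \<eta> (\<eta> *\<^sub>R z)) = z"
    by (simp add: rodrigues_def X_def)
qed

section \<open>Differential inequalities on the half line\<close>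

lemma half_line_derivative_nonpos:
  fixes f :: "real \<Rightarrow> real"
  assumes der: "\<And>t. t \<ge> 0 \<Longrightarrow> (f has_vector_derivative f' t) (at t within {0..})"
    and le: "\<And>t. t \<ge> 0 \<Longrightarrow> f' t \<le> 0" and t: "t \<ge> 0"
  shows "f t \<le> f 0"
proof (rule DERIV_nonpos_imp_decreasing_open[OF t])
  fix s :: real assume s: "0 < s" "s < t"
  have "at s within {0..} = at s"
    using s by (intro at_within_interior) simp
  then show "\<exists>y. (f has_real_derivative y) (at s) \<and> y \<le> 0"
    using der[of s] le[of s] s by (auto simp: has_real_derivative_iff_has_vector_derivative)
next
  have "continuous_on {0..} f"
    unfolding continuous_on_eq_continuous_within
    using der has_vector_derivative_continuous by fastforce
  then show "continuous_on {0..t} f" by (rule continuous_on_subset) simp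
qed

text \<open>
  The weighted function \<open>exp (- K t) f t\<close> is nonincreasing.
\<close>

lemma half_line_gronwall:
  fixes f :: "real \<Rightarrow> real"
  assumes der: "\<And>t. t \<ge> 0 \<Longrightarrow> (f has_vector_derivative f' t) (at t within {0..})"
    and le: "\<And>t. t \<ge> 0 \<Longrightarrow> f' t \<le> K * f t" and t: "t \<ge> 0"
  shows "f t \<le> exp (K * t) * f 0"
proof -
  have "exp (- K * t) * f t \<le> exp (- K * 0) * f 0"
  proof (rule half_line_derivative_nonpos[where f' = "\<lambda>t. exp (- K * t) * (f' t - K * f t)", OF _ _ t])
    fix t :: real assume t: "t \<ge> 0"
    note [derivative_intros] = der[OF t, folded has_real_derivative_iff_has_vector_derivative]
    show "((\<lambda>t. exp (- K * t) * f t) has_vector_derivative exp (- K * t) * (f' t - K * f t)) (at t within {0..})"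
      unfolding has_real_derivative_iff_has_vector_derivative[symmetric]
      by (auto intro!: derivative_eq_intros simp: algebra_simps)
    show "exp (- K * t) * (f' t - K * f t) \<le> 0"
      using le[OF t] by (simp add: mult_le_0_iff)
  qed
  then have "exp (K * t) * (exp (- K * t) * f t) \<le> exp (K * t) * f 0" by simp
  moreover have "exp (K * t) * (exp (- K * t) * f t) = f t" by (simp add: exp_minus)
  ultimately show ?thesis by metis
qed

section \<open>The matrix exponential\<close>

lemma exp_series_summable:
  fixes p :: "nat \<Rightarrow> 'a::banach"
  assumes "\<And>n. norm (p n) \<le> C * K ^ n"
  shows "summable (\<lambda>n. (t ^ n / fact n) *\<^sub>R p n)"
proof (rule summable_comparison_test')
  show "summable (\<lambda>n. C * (inverse (fact n) * (\<bar>t\<bar> * K) ^ n))"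
    by (intro summable_mult summable_exp)
  fix n :: nat
  have "norm ((t ^ n / fact n) *\<^sub>R p n) = (\<bar>t\<bar> ^ n / fact n) * norm (p n)"
    by (simp add: power_abs)
  also have "\<dots> \<le> (\<bar>t\<bar> ^ n / fact n) * (C * K ^ n)"
    by (intro mult_left_mono assms) simp
  finally show "norm ((t ^ n / fact n) *\<^sub>R p n) \<le> C * (inverse (fact n) * (\<bar>t\<bar> * K) ^ n)"
    by (simp add: power_mult_distrib divide_inverse mult_ac)
qed

text \<open>
  Every coordinate is a real power series that converges everywhere, so termwise
  differentiation of scalar power series applies coordinate by coordinate. The coefficients \<open>p n\<close> stand
  for the powers of a matrix; working with a general sequence avoids a Banach algebra structure on
  matrices.
\<close>

lemma exp_series_has_vector_derivative:
  fixes p :: "nat \<Rightarrow> 'a::euclidean_space"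
  assumes bound: "\<And>n. norm (p n) \<le> C * K ^ n"
  shows "((\<lambda>t. \<Sum>n. (t ^ n / fact n) *\<^sub>R p n) has_vector_derivative
           (\<Sum>n. (t ^ n / fact n) *\<^sub>R p (Suc n))) (at t)"
proof -
  have bound': "norm (p (Suc n)) \<le> (C * K) * K ^ n" for n
    using bound[of "Suc n"] by (simp add: mult_ac)
  note sums = exp_series_summable[OF bound] and sums' = exp_series_summable[OF bound']
  have coord: "(\<Sum>n. (t ^ n / fact n) *\<^sub>R q n) \<bullet> b = (\<Sum>n. (q n \<bullet> b / fact n) * t ^ n)"
    if "summable (\<lambda>n. (t ^ n / fact n) *\<^sub>R q n)" for q b and t :: real
    using bounded_linear.suminf[OF bounded_linear_inner_left that, of b]
    by (simp add: mult_ac)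
  have "((\<lambda>t. (\<Sum>n. (t ^ n / fact n) *\<^sub>R p n) \<bullet> b) has_vector_derivative
           (\<Sum>n. (t ^ n / fact n) *\<^sub>R p (Suc n)) \<bullet> b) (at t)" for b
  proof -
    let ?c = "\<lambda>n. p n \<bullet> b / fact n"
    have "summable (\<lambda>n. ?c n * y ^ n)" for y
      using bounded_linear.summable[OF bounded_linear_inner_left[of b] exp_series_summable[OF bound, of y]]
      by (simp add: mult_ac)
    from termdiffs_strong_converges_everywhere[OF this, of t]
    have "((\<lambda>t. \<Sum>n. ?c n * t ^ n) has_real_derivative (\<Sum>n. diffs ?c n * t ^ n)) (at t)" .
    moreover have "diffs ?c n = p (Suc n) \<bullet> b / fact n" for n
      by (simp add: diffs_def field_simps del: of_nat_Suc)
    ultimately show ?thesis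
      unfolding coord[OF sums] coord[OF sums'] has_real_derivative_iff_has_vector_derivative[symmetric]
      by (simp only:)
  qed
  then show ?thesis
    unfolding has_vector_derivative_def
    by (intro has_derivative_componentwise_within[THEN iffD2]) simp
qed

lemma matrix_exp_has_vector_derivative:
  "((\<lambda>t. matrix_exp (t *\<^sub>R M)) has_vector_derivative M ** matrix_exp (t *\<^sub>R M)) (at t)"
proof -
  let ?p = "\<lambda>n. (((**) M) ^^ n) (mat 1)"
  obtain K where K: "K > 0" "\<And>N :: real^3^3. norm (M ** N) \<le> norm N * K"
    using bounded_linear.pos_bounded[OF matrix_mult.bounded_linear_right] by blast
  have bound: "norm (?p n) \<le> norm (mat 1 :: real^3^3) * K ^ n" for n
  proof (induction n)
    case (Suc n)
    have "norm (?p (Suc n)) \<le> norm (?p n) * K" using K(2) by simp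
    also have "\<dots> \<le> norm (mat 1 :: real^3^3) * K ^ n * K"
      using Suc K(1) by (intro mult_right_mono) auto
    finally show ?case by (simp add: mult_ac)
  qed simp
  have pow: "(((**) (t *\<^sub>R M)) ^^ n) (mat 1) = t ^ n *\<^sub>R ?p n" for t n
    by (induction n) (simp_all add: matrix_mult.scaleR_left matrix_mult.scaleR_right)
  have exp: "matrix_exp (t *\<^sub>R M) = (\<Sum>n. (t ^ n / fact n) *\<^sub>R ?p n)" for t
    by (simp add: matrix_exp_def pow)
  have series: "(\<lambda>t. matrix_exp (t *\<^sub>R M)) = (\<lambda>t. \<Sum>n. (t ^ n / fact n) *\<^sub>R ?p n)"
    by (rule ext) (rule exp)
  have shifted: "M ** matrix_exp (t *\<^sub>R M) = (\<Sum>n. (t ^ n / fact n) *\<^sub>R ?p (Suc n))"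
  proof -
    have "M ** (\<Sum>n. (t ^ n / fact n) *\<^sub>R ?p n) = (\<Sum>n. M ** ((t ^ n / fact n) *\<^sub>R ?p n))"
      by (rule bounded_linear.suminf[OF matrix_mult.bounded_linear_right exp_series_summable[OF bound]])
    also have "\<dots> = (\<Sum>n. (t ^ n / fact n) *\<^sub>R ?p (Suc n))"
      by (simp only: matrix_mult.scaleR_right funpow.simps comp_def)
    finally show ?thesis by (simp only: exp)
  qed
  show ?thesis
    unfolding shifted unfolding series by (rule exp_series_has_vector_derivative[OF bound])
qed

lemma matrix_exp_0: "matrix_exp 0 = mat 1"
proof -
  have "matrix_exp 0 = (\<Sum>n. if n = 0 then mat 1 else 0)"
    unfolding matrix_exp_def
  proof (intro suminf_cong)
    fix n show "(1 / fact n) *\<^sub>R ((**) 0 ^^ n) (mat 1) = (if n = 0 then mat 1 else (0::real^3^3))"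
      by (cases n) (simp_all add: matrix_mult.zero_left)
  qed
  also have "\<dots> = mat 1"
    using suminf_finite[of "{0::nat}" "\<lambda>n. if n = 0 then mat 1 else (0::real^3^3)"] by simp
  finally show ?thesis .
qed

section \<open>Eigenvectors of symmetric matrices\<close>

lemma symmetric_inner:
  fixes A :: "real^'n^'n"
  assumes "transpose A = A"
  shows "x \<bullet> (A *v y) = (A *v x) \<bullet> y"
  by (metis assms dot_lmul_matrix transpose_matrix_vector)

text \<open>
  A maximiser \<open>v\<close> of the quadratic form on the unit sphere of the invariant subspace is an
  eigenvector. With the maximum \<open>c\<close>, the form \<open>Q y = c (y \<bullet> y) - y \<bullet> A y\<close> is nonnegative on \<open>S\<close> and zero at \<open>v\<close>,
  so its derivative at \<open>v\<close> in the direction \<open>r = c v - A v\<close>, which is \<open>2 (r \<bullet> r)\<close>, must be zero.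
\<close>

lemma symmetric_eigenvector_in_subspace:
  fixes A :: "real^'n^'n"
  assumes sym: "transpose A = A" and S: "subspace S" "\<And>x. x \<in> S \<Longrightarrow> A *v x \<in> S"
    and x: "x \<in> S" "x \<noteq> 0"
  obtains v c where "v \<in> S" "norm v = 1" "A *v v = c *\<^sub>R v"
proof -
  let ?K = "S \<inter> sphere 0 1"
  have "x /\<^sub>R norm x \<in> ?K" using x S(1) by (simp add: subspace_scale)
  moreover have "compact ?K" by (simp add: S(1) closed_Int_compact closed_subspace)
  moreover have "continuous_on ?K (\<lambda>x. x \<bullet> (A *v x))"
    by (intro continuous_intros matrix_vector_mult_linear_continuous_on)
  ultimately obtain v where v: "v \<in> ?K" "\<And>y. y \<in> ?K \<Longrightarrow> y \<bullet> (A *v y) \<le> v \<bullet> (A *v v)"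
    using continuous_attains_sup[of ?K "\<lambda>x. x \<bullet> (A *v x)"] by blast
  define c where "c = v \<bullet> (A *v v)"
  define Q where "Q y = c * (y \<bullet> y) - y \<bullet> (A *v y)" for y
  have Q_nonneg: "Q y \<ge> 0" if "y \<in> S" for y
  proof (cases "y = 0")
    case False
    have "y /\<^sub>R norm y \<in> ?K" using that False S(1) by (simp add: subspace_scale)
    then have "(y /\<^sub>R norm y) \<bullet> (A *v (y /\<^sub>R norm y)) \<le> c" unfolding c_def by (rule v(2))
    then have "(y \<bullet> (A *v y)) / (norm y)\<^sup>2 \<le> c"
      by (simp add: matrix_vector_mult.scaleR_right power2_eq_square divide_inverse mult_ac)
    then show ?thesis
      using False by (simp add: Q_def dot_square_norm field_simps)
  qed (simp add: Q_def)
  define r where "r = c *\<^sub>R v - A *v v"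
  have rS: "r \<in> S" using v(1) S by (simp add: r_def subspace_diff subspace_scale)
  have vv: "v \<bullet> v = 1" using v(1) by (simp add: dot_square_norm)
  have expand: "Q (v + t *\<^sub>R r) = 2 * t * (r \<bullet> r) + t\<^sup>2 * Q r" for t
  proof -
    have "Q v = 0" by (simp add: Q_def c_def vv)
    moreover have "r \<bullet> r = c * (v \<bullet> r) - v \<bullet> (A *v r)"
      by (subst (1) r_def) (simp add: inner_diff_left symmetric_inner[OF sym])
    moreover have "r \<bullet> (A *v v) = v \<bullet> (A *v r)"
      by (metis symmetric_inner[OF sym] inner_commute)
    moreover have "Q (v + t *\<^sub>R r)
        = Q v + t * (2 * c * (v \<bullet> r) - v \<bullet> (A *v r) - r \<bullet> (A *v v)) + t\<^sup>2 * Q r"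
      by (simp add: Q_def matrix_vector_mult.add_right matrix_vector_mult.scaleR_right inner_add_left
          inner_add_right inner_commute[of r v] power2_eq_square algebra_simps)
    ultimately show ?thesis by simp
  qed
  have "r = 0"
  proof (rule ccontr)
    assume "r \<noteq> 0"
    then have r: "r \<bullet> r > 0" by simp
    \<comment> \<open>A step against \<open>r\<close>, short enough for the linear term of \<open>Q\<close> to beat the quadratic one.\<close>
    define s where "s = (r \<bullet> r) / (Q r + 1)"
    have Qr: "Q r \<ge> 0" using Q_nonneg[OF rS] .
    then have s: "s > 0" using r by (simp add: s_def)
    have "0 \<le> Q (v + (- s) *\<^sub>R r)"
      using rS v(1) S(1) by (intro Q_nonneg) (simp add: subspace_diff subspace_scale)
    then have "s * (2 * (r \<bullet> r)) \<le> s * (s * Q r)"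
      unfolding expand by (simp add: power2_eq_square algebra_simps)
    then have "2 * (r \<bullet> r) \<le> s * Q r" using s by simp
    moreover have "s * Q r \<le> r \<bullet> r"
      using Qr r by (simp add: s_def field_simps)
    ultimately show False using r by simp
  qed
  then show ?thesis using v(1) by (intro that[of v c]) (simp_all add: r_def)
qed

section \<open>The error dynamics\<close>

lemma at_within_half_line:
  fixes t :: real
  assumes "t \<ge> 0"
  shows "at t within {0..} \<noteq> bot"
proof -
  have "at_right t \<le> at t within {0..}" using assms by (intro at_le) auto
  then show ?thesis using trivial_limit_at_right_real[of t] by (metis bot_unique)
qed

text \<open>
  Conjugation by rotations preserves the Frobenius norm; this is the infinitesimal form of
  that fact.
\<close>

lemma inner_commutator_skew: "M \<bullet> (M ** skew s - skew s ** M) = 0"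
  by (simp add: mat3_simps algebra_simps)

text \<open>
  Orthogonality is an invariant by the energy of \<open>D = Y ** transpose Y - I\<close>: the body rate \<open>\<omega>\<close>
  cancels and \<open>D' = D [s] - [s] D\<close>, so the norm of \<open>D\<close> is constant. The determinant is then \<open>1\<close> or \<open>- 1\<close>, and it cannot jump.
\<close>

lemma observer_in_SO3:
  assumes init: "Y 0 \<in> SO3"
    and der: "\<And>t. t \<ge> 0 \<Longrightarrow> (Y has_vector_derivative Y t ** skew (\<omega> t) - skew (s t) ** Y t) (at t within {0..})"
    and t: "t \<ge> 0"
  shows "Y t \<in> SO3"
proof -
  define D where "D t = Y t ** transpose (Y t) - mat 1" for t
  have D: "(D has_vector_derivative D t ** skew (s t) - skew (s t) ** D t) (at t within {0..})"
    if "t \<ge> 0" for t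
  proof -
    note d = der[OF that]
    from matrix_mult.has_vector_derivative[OF d bounded_linear.has_vector_derivative[OF bounded_linear_transpose d]]
    have "((\<lambda>t. Y t ** transpose (Y t)) has_vector_derivative
        Y t ** transpose (Y t ** skew (\<omega> t) - skew (s t) ** Y t)
        + (Y t ** skew (\<omega> t) - skew (s t) ** Y t) ** transpose (Y t)) (at t within {0..})" .
    moreover have "Y t ** transpose (Y t ** skew (\<omega> t) - skew (s t) ** Y t)
        + (Y t ** skew (\<omega> t) - skew (s t) ** Y t) ** transpose (Y t)
      = D t ** skew (s t) - skew (s t) ** D t"
      by (simp add: D_def transpose_diff matrix_transpose_mul matrix_mult.diff_left matrix_mult.diff_right
          matrix_mult.minus_left matrix_mult.minus_right matrix_mul_assoc)
    ultimately show ?thesis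
      unfolding D_def by (auto intro!: derivative_eq_intros)
  qed
  have D_le: "D t \<bullet> D t \<le> D 0 \<bullet> D 0" if "t \<ge> 0" for t
  proof (rule half_line_derivative_nonpos[where f' = "\<lambda>_. 0", OF _ _ that])
    fix t :: real assume "t \<ge> 0"
    from bounded_bilinear.has_vector_derivative[OF bounded_bilinear_inner D[OF this] D[OF this]]
    show "((\<lambda>t. D t \<bullet> D t) has_vector_derivative 0) (at t within {0..})"
      by (simp add: inner_commutator_skew inner_commute)
  qed simp
  have orth: "Y t ** transpose (Y t) = mat 1" if "t \<ge> 0" for t
  proof -
    have "D 0 = 0" using init by (simp add: D_def SO3_def)
    then have "D t \<bullet> D t = 0" using D_le[OF that] inner_ge_zero[of "D t"] by simp
    then have "D t = 0" by simp
    then show ?thesis by (simp add: D_def)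
  qed
  have det_sq: "det (Y t) * det (Y t) = 1" if "t \<ge> 0" for t
    using arg_cong[OF orth[OF that], of det] by (simp add: det_mul)
  have "continuous_on {0..} Y"
    unfolding continuous_on_eq_continuous_within
    using der has_vector_derivative_continuous by fastforce
  then have cont: "continuous_on {0..t} (\<lambda>t. det (Y t))"
    unfolding det_3 by (intro continuous_intros) (auto elim: continuous_on_subset)
  have "det (Y t) = 1"
  proof (rule ccontr)
    assume "det (Y t) \<noteq> 1"
    then have "det (Y t) = - 1" using det_sq[OF t] by (auto simp: square_eq_1_iff)
    then obtain u where "0 \<le> u" "det (Y u) = 0"
      using IVT2'[of "\<lambda>t. det (Y t)" t 0 0, OF _ _ t cont] init by (auto simp: SO3_def)
    then show False using det_sq[of u] by simp
  qed
  then show ?thesis using orth[OF t] by (simp add: SO3_def)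
qed

text \<open>
  The autonomous closed-loop equation on the rotation group, without reference to the attitude
  motion \<open>R\<close> and the angular velocity.
\<close>

definition error_ode :: "real^3^3 \<Rightarrow> (real \<Rightarrow> real^3^3) \<Rightarrow> bool" where
  "error_ode A X \<longleftrightarrow> (\<forall>t\<ge>0. X t \<in> SO3 \<and>
     (X has_vector_derivative - (X t ** skew (psi (A ** X t)))) (at t within {0..}))"

lemma SO3_mult:
  assumes "X \<in> SO3" "Y \<in> SO3" shows "X ** Y \<in> SO3"
proof -
  have "(X ** Y) ** transpose (X ** Y) = X ** (Y ** transpose Y) ** transpose X"
    by (simp only: matrix_transpose_mul matrix_mul_assoc)
  then show ?thesis using assms by (simp add: SO3_def det_mul)
qed

lemma SO3_transpose: "X \<in> SO3 \<Longrightarrow> transpose X \<in> SO3"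
  by (simp add: SO3_def matrix_left_right_inverse)

lemma error_trajectories_ode:
  assumes kin: "attitude_kinematics \<omega> R" and X: "X \<in> error_trajectories A \<omega> R"
  shows "error_ode A X"
proof -
  obtain Y where obs: "attitude_observer A \<omega> R Y" and XY: "\<And>t. t \<ge> 0 \<Longrightarrow> X t = R t ** transpose (Y t)"
    using X by (auto simp: error_trajectories_def)
  define s where "s t = innovation A (R t) (Y t)" for t
  have Y: "(Y has_vector_derivative Y t ** skew (\<omega> t) - skew (s t) ** Y t) (at t within {0..})"
    if "t \<ge> 0" for t
    using obs that by (simp add: attitude_observer_def s_def)
  have R: "R t \<in> SO3" "(R has_vector_derivative R t ** skew (\<omega> t)) (at t within {0..})" if "t \<ge> 0" for t
    using kin that by (simp_all add: attitude_kinematics_def)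
  have YSO: "Y t \<in> SO3" if "t \<ge> 0" for t
    using observer_in_SO3[OF _ Y that] obs by (simp add: attitude_observer_def)
  have "X t \<in> SO3 \<and> (X has_vector_derivative - (X t ** skew (psi (A ** X t)))) (at t within {0..})"
    if t: "t \<ge> 0" for t
  proof
    show "X t \<in> SO3" using XY[OF t] R(1)[OF t] YSO[OF t] by (simp add: SO3_mult SO3_transpose)
    have s: "s t = - psi (A ** X t)" by (simp add: s_def innovation_def XY[OF t] matrix_mul_assoc)
    have "((\<lambda>t. R t ** transpose (Y t)) has_vector_derivative
        R t ** transpose (Y t ** skew (\<omega> t) - skew (s t) ** Y t)
        + (R t ** skew (\<omega> t)) ** transpose (Y t)) (at t within {0..})"
      by (rule matrix_mult.has_vector_derivative[OF R(2)[OF t]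
            bounded_linear.has_vector_derivative[OF bounded_linear_transpose Y[OF t]]])
    moreover have "R t ** transpose (Y t ** skew (\<omega> t) - skew (s t) ** Y t)
        + (R t ** skew (\<omega> t)) ** transpose (Y t) = - (X t ** skew (psi (A ** X t)))"
      by (simp add: s skew_minus XY[OF t] transpose_add transpose_diff matrix_transpose_mul matrix_mult.diff_right
          matrix_mult.add_right
          matrix_mult.minus_left matrix_mult.minus_right matrix_mul_assoc)
    ultimately show "(X has_vector_derivative - (X t ** skew (psi (A ** X t)))) (at t within {0..})"
      using has_vector_derivative_transform[of t "{0..}" X "\<lambda>t. R t ** transpose (Y t)"] t XY by simp
  qed
  then show ?thesis by (simp add: error_ode_def)
qed

text \<open>
  A constant error \<open>X\<close> has derivative \<open>0\<close>, which is compared at time \<open>0\<close> with the error equation.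
  Conversely the estimate \<open>transpose X ** R t\<close> realises the error \<open>X\<close> and needs no correction.
\<close>

lemma equilibria_eq:
  assumes kin: "attitude_kinematics \<omega> R"
  shows "equilibria (error_trajectories A \<omega> R) = {X \<in> SO3. psi (A ** X) = 0}"
proof (intro set_eqI iffI)
  fix X assume "X \<in> equilibria (error_trajectories A \<omega> R)"
  then have "error_ode A (\<lambda>_. X)" by (simp add: equilibria_def error_trajectories_ode[OF kin])
  then have X: "X \<in> SO3"
    and "((\<lambda>_. X) has_vector_derivative - (X ** skew (psi (A ** X)))) (at 0 within {0::real..})"
    by (auto simp: error_ode_def)
  moreover have "((\<lambda>_. X) has_vector_derivative 0) (at 0 within {0::real..})" by simp
  moreover have "at 0 within {0::real..} \<noteq> bot" by (rule at_within_half_line) simp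
  ultimately have "X ** skew (psi (A ** X)) = 0"
    using vector_derivative_unique_within by fastforce
  then have "transpose X ** X ** skew (psi (A ** X)) = 0"
    by (simp add: matrix_mult.zero_right flip: matrix_mul_assoc)
  then have "skew (psi (A ** X)) = skew 0"
    using SO3_transpose[OF X] by (simp add: SO3_def skew_zero)
  then show "X \<in> {X \<in> SO3. psi (A ** X) = 0}" using X by (simp add: inj_eq[OF inj_skew])
next
  fix X assume "X \<in> {X \<in> SO3. psi (A ** X) = 0}"
  then have X: "X \<in> SO3" "psi (A ** X) = 0" by auto
  let ?Y = "\<lambda>t. transpose X ** R t"
  have R: "R t \<in> SO3" "(R has_vector_derivative R t ** skew (\<omega> t)) (at t within {0..})" if "t \<ge> 0" for t
    using kin that by (simp_all add: attitude_kinematics_def)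
  have err: "R t ** transpose (?Y t) = X" if "t \<ge> 0" for t
    using R(1)[OF that] by (simp add: SO3_def matrix_transpose_mul matrix_mul_assoc)
  have "innovation A (R t) (?Y t) = 0" if "t \<ge> 0" for t
    using err[OF that] X(2) by (simp add: innovation_def flip: matrix_mul_assoc)
  moreover have "(?Y has_vector_derivative ?Y t ** skew (\<omega> t)) (at t within {0..})" if "t \<ge> 0" for t
    using bounded_linear.has_vector_derivative[OF matrix_mult.bounded_linear_right R(2)[OF that]]
    by (simp add: matrix_mul_assoc)
  moreover have "?Y 0 \<in> SO3" using R(1)[of 0] X(1) by (simp add: SO3_mult SO3_transpose)
  ultimately have "attitude_observer A \<omega> R ?Y"
    by (simp add: attitude_observer_def skew_zero matrix_mult.zero_left)
  then show "X \<in> equilibria (error_trajectories A \<omega> R)"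
    using err by (auto simp: equilibria_def error_trajectories_def)
qed

section \<open>Equilibria\<close>

lemma pos_def_inner_nonneg: "pos_def M \<Longrightarrow> 0 \<le> x \<bullet> (M *v x)"
  by (cases "x = 0") (auto simp: pos_def_def less_imp_le)

text \<open>
  For the quaternion \<open>(\<eta>, \<epsilon>)\<close> of \<open>X\<close> the equation reads \<open>2 \<eta> bar A \<epsilon> + \<epsilon> \<times> A \<epsilon> = 0\<close>. The two terms are
  separated by the inner product with \<open>\<epsilon>\<close>, which annihilates the second.
\<close>

lemma psi_mult_eq_0_iff:
  assumes sym: "transpose A = A" and pd: "pos_def (bar A)"
  shows "{X \<in> SO3. psi (A ** X) = 0} = {mat 1} \<union> angle_axis pi ` unit_eigenvectors A"
proof (intro set_eqI iffI)
  fix X assume "X \<in> {X \<in> SO3. psi (A ** X) = 0}"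
  then have X: "X \<in> SO3" "psi (A ** X) = 0" by auto
  obtain \<eta> \<epsilon> where e: "\<eta>\<^sup>2 + \<epsilon> \<bullet> \<epsilon> = 1" "X = quat_rot \<eta> \<epsilon>" using SO3_quat_rot[OF X(1)] .
  have z: "(2 * \<eta>) *\<^sub>R (bar A *v \<epsilon>) + cross3 \<epsilon> (A *v \<epsilon>) = 0"
    using X(2) by (simp add: e(2) psi_mult_quat_rot[OF sym])
  have "\<eta> * (\<epsilon> \<bullet> (bar A *v \<epsilon>)) = 0"
    using arg_cong[OF z, of "inner \<epsilon>"] by (simp add: inner_add_right dot_cross_self)
  then consider "\<epsilon> = 0" | "\<eta> = 0" "\<epsilon> \<noteq> 0"
    using pd by (force simp: pos_def_def)
  then show "X \<in> {mat 1} \<union> angle_axis pi ` unit_eigenvectors A"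
  proof cases
    case 1
    then show ?thesis by (simp add: e(2) quat_rot_def skew_zero matrix_mult.zero_left)
  next
    case 2
    then have "norm \<epsilon> = 1" using e(1) by (simp add: norm_eq_sqrt_inner)
    moreover have "collinear {0, \<epsilon>, A *v \<epsilon>}" using z 2 by (simp add: cross_eq_0)
    then have "\<exists>c. A *v \<epsilon> = c *\<^sub>R \<epsilon>"
      using 2(2) unfolding collinear_lemma by (metis scaleR_zero_left)
    ultimately show ?thesis
      using 2 by (auto simp: unit_eigenvectors_def angle_axis_def e(2) quat_rot_def)
  qed
next
  fix X assume "X \<in> {mat 1} \<union> angle_axis pi ` unit_eigenvectors A"
  then consider "X = quat_rot 1 0" | v c where "X = quat_rot 0 v" "norm v = 1" "A *v v = c *\<^sub>R v"
    by (auto simp: unit_eigenvectors_def angle_axis_def quat_rot_def skew_zero matrix_mult.zero_left)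
  then show "X \<in> {X \<in> SO3. psi (A ** X) = 0}"
  proof cases
    case 1
    then have "X = mat 1" by (simp add: quat_rot_def skew_zero matrix_mult.zero_left)
    moreover have "psi (A ** X) = 0" using psi_mult_quat_rot[OF sym, of 1 0] 1 by simp
    ultimately show ?thesis by (simp add: SO3_def)
  next
    case 2
    then show ?thesis
      by (simp add: psi_mult_quat_rot[OF sym] half_turn_in_SO3 cross_mult_right)
  qed
qed

text \<open>
  Two orthogonal eigenvectors come from the variational principle, and their cross product
  is a third one by symmetry of \<open>A\<close>. The half turns about orthogonal axes differ, as the first fixes its
  axis and the second reverses it.
\<close>

lemma four_critical_rotations:
  assumes sym: "transpose A = A"
  shows "\<exists>S \<subseteq> {mat 1} \<union> angle_axis pi ` unit_eigenvectors A. card S = 4"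
proof -
  obtain u c where u: "norm u = 1" "A *v u = c *\<^sub>R u"
    using symmetric_eigenvector_in_subspace[OF sym subspace_UNIV, of "axis 1 1"]
    by (auto simp: axis_eq_0_iff)
  obtain x where x: "norm x = 1" "u \<bullet> x = 0" using unit_orthogonal_vector .
  obtain v d where v: "u \<bullet> v = 0" "norm v = 1" "A *v v = d *\<^sub>R v"
  proof (rule symmetric_eigenvector_in_subspace[OF sym subspace_hyperplane[of u], of x])
    show "A *v y \<in> {x. u \<bullet> x = 0}" if "y \<in> {x. u \<bullet> x = 0}" for y
      using that u(2) by (simp add: symmetric_inner[OF sym])
  qed (use x in auto)
  have uu: "u \<bullet> u = 1" and vv: "v \<bullet> v = 1" using u v by (simp_all add: dot_square_norm)
  define w where "w = cross3 u v"
  have wu: "w \<bullet> u = 0" "w \<bullet> v = 0" and w: "norm w = 1"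
    using orthonormal_cross[OF uu vv v(1)] by (simp_all add: w_def norm_eq_sqrt_inner)
  have "(A *v w) \<bullet> u = 0" "(A *v w) \<bullet> v = 0"
    by (simp_all add: symmetric_inner[OF sym, symmetric] u v wu)
  then have Aw: "A *v w = ((A *v w) \<bullet> w) *\<^sub>R w"
    using orthonormal_frame_expansion[OF uu vv v(1), of "A *v w"] by (simp add: w_def)
  let ?H = "quat_rot 0"
  have H: "angle_axis pi x = ?H x" for x by (simp add: angle_axis_def quat_rot_def)
  have fixed: "?H x *v x = x" if "norm x = 1" for x
    using half_turn_vec[OF that, of x] that by (simp add: dot_square_norm scaleR_2)
  have reversed: "?H x *v y = - y" if "norm x = 1" "x \<bullet> y = 0" for x y
    using half_turn_vec[OF that(1), of y] that(2) by simp
  have neg: "- y \<noteq> y" if "norm y = 1" for y :: "real^3"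
  proof
    assume "- y = y"
    then have "2 *\<^sub>R y = 0" by (metis left_minus scaleR_2)
    then show False using that by simp
  qed
  have ne: "?H x \<noteq> ?H y" if "norm x = 1" "norm y = 1" "x \<bullet> y = 0" for x y
    using fixed[OF that(2)] reversed[OF that(1,3)] neg[OF that(2)] by metis
  have ne1: "?H x \<noteq> mat 1" if "norm x = 1" for x
  proof -
    obtain y where y: "norm y = 1" "x \<bullet> y = 0" using unit_orthogonal_vector .
    then show ?thesis using reversed[OF that y(2)] neg[OF y(1)] by (metis matrix_vector_mul_lid)
  qed
  have "card {mat 1, ?H u, ?H v, ?H w} = 4"
    using ne[OF u(1) v(2)] ne[OF u(1) w] ne[OF v(2) w] ne1[OF u(1)] ne1[OF v(2)] ne1[OF w] v(1) wu
    by (auto simp: inner_commute card_insert_if)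
  moreover have "{u, v, w} \<subseteq> unit_eigenvectors A"
    using u v w Aw by (auto simp: unit_eigenvectors_def)
  then have "{mat 1, ?H u, ?H v, ?H w} \<subseteq> {mat 1} \<union> angle_axis pi ` unit_eigenvectors A"
    unfolding H[symmetric] by auto
  ultimately show ?thesis by blast
qed

section \<open>The half turns are invariant and repelling\<close>

text \<open>
  Here \<open>trace (M [v]) = - 2 (psi M \<bullet> v)\<close> and \<open>psi X = 2 \<eta> \<epsilon>\<close>, and the part \<open>\<epsilon> \<times> A \<epsilon>\<close> of \<open>psi (A ** X)\<close> is
  orthogonal to \<open>\<epsilon>\<close>. The factor \<open>1 + trace X\<close>, which vanishes exactly on the half turns, is what makes
  them invariant.
\<close>

lemma trace_rate:
  assumes sym: "transpose A = A" and q: "\<eta>\<^sup>2 + \<epsilon> \<bullet> \<epsilon> = 1" and X: "X = quat_rot \<eta> \<epsilon>"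
  shows "trace (- (X ** skew (psi (A ** X)))) = 2 * (1 + trace X) * (\<epsilon> \<bullet> (bar A *v \<epsilon>))"
proof -
  have "trace (- (X ** skew (psi (A ** X)))) = 2 * (psi X \<bullet> psi (A ** X))"
    by (simp add: linear_neg[OF trace_linear] trace_mult_skew)
  also have "\<dots> = 8 * \<eta>\<^sup>2 * (\<epsilon> \<bullet> (bar A *v \<epsilon>))"
    unfolding X psi_quat_rot psi_mult_quat_rot[OF sym]
    by (simp add: inner_add_right dot_cross_self power2_eq_square)
  finally show ?thesis using trace_quat_rot[OF q] by (simp add: X)
qed

lemma one_plus_trace_nonneg:
  assumes "X \<in> SO3" shows "0 \<le> 1 + trace X"
proof -
  obtain \<eta> \<epsilon> where "\<eta>\<^sup>2 + \<epsilon> \<bullet> \<epsilon> = 1" "X = quat_rot \<eta> \<epsilon>" using SO3_quat_rot[OF assms] .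
  then show ?thesis using trace_quat_rot by simp
qed

lemma trace_rate_bounds:
  assumes sym: "transpose A = A" and pd: "pos_def (bar A)"
  obtains K where "\<And>X. X \<in> SO3 \<Longrightarrow> 0 \<le> trace (- (X ** skew (psi (A ** X))))"
    "\<And>X. X \<in> SO3 \<Longrightarrow> trace (- (X ** skew (psi (A ** X)))) \<le> K * (1 + trace X)"
proof -
  obtain B where B: "B > 0" "\<And>x. norm (bar A *v x) \<le> norm x * B"
    using bounded_linear.pos_bounded[OF matrix_vector_mult.bounded_linear_right] by blast
  have "0 \<le> trace (- (X ** skew (psi (A ** X)))) \<and>
      trace (- (X ** skew (psi (A ** X)))) \<le> (2 * B) * (1 + trace X)" if X: "X \<in> SO3" for X
  proof -
    obtain \<eta> \<epsilon> where e: "\<eta>\<^sup>2 + \<epsilon> \<bullet> \<epsilon> = 1" "X = quat_rot \<eta> \<epsilon>"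
      using SO3_quat_rot[OF X] .
    have nonneg: "0 \<le> 1 + trace X" by (rule one_plus_trace_nonneg[OF X])
    have "\<epsilon> \<bullet> (bar A *v \<epsilon>) \<le> norm \<epsilon> * norm (bar A *v \<epsilon>)" by (rule norm_cauchy_schwarz)
    also have "\<dots> \<le> norm \<epsilon> * (norm \<epsilon> * B)" by (intro mult_left_mono B(2)) simp
    also have "\<dots> = (\<epsilon> \<bullet> \<epsilon>) * B" by (simp add: dot_square_norm power2_eq_square)
    also have "\<dots> \<le> 1 * B" using e(1) B(1) zero_le_power2[of \<eta>] by (intro mult_right_mono) linarith+
    finally have "\<epsilon> \<bullet> (bar A *v \<epsilon>) \<le> B" by simp
    then have "2 * (1 + trace X) * (\<epsilon> \<bullet> (bar A *v \<epsilon>)) \<le> 2 * (1 + trace X) * B"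
      using nonneg by (intro mult_left_mono) auto
    moreover have "0 \<le> 2 * (1 + trace X) * (\<epsilon> \<bullet> (bar A *v \<epsilon>))"
      using nonneg pos_def_inner_nonneg[OF pd] by simp
    ultimately show ?thesis unfolding trace_rate[OF sym e] by (simp add: mult_ac)
  qed
  then show ?thesis by (intro that[of "2 * B"]) auto
qed

lemma error_ode_trace:
  assumes "error_ode A X" "t \<ge> 0"
  shows "((\<lambda>t. 1 + trace (X t)) has_vector_derivative
     trace (- (X t ** skew (psi (A ** X t))))) (at t within {0..})"
proof -
  have "(X has_vector_derivative - (X t ** skew (psi (A ** X t)))) (at t within {0..})"
    using assms by (simp add: error_ode_def)
  from has_vector_derivative_add[OF has_vector_derivative_const
      bounded_linear.has_vector_derivative[OF bounded_linear_trace this]]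
  show ?thesis by simp
qed

lemma error_ode_trace_mono:
  assumes sym: "transpose A = A" and pd: "pos_def (bar A)" and ode: "error_ode A X" and t: "t \<ge> 0"
  shows "1 + trace (X 0) \<le> 1 + trace (X t)"
proof -
  obtain K where "\<And>X. X \<in> SO3 \<Longrightarrow> 0 \<le> trace (- (X ** skew (psi (A ** X))))"
    using trace_rate_bounds[OF sym pd] by metis
  then have "- trace (- (X t ** skew (psi (A ** X t)))) \<le> 0" if "t \<ge> 0" for t
    using ode that by (simp add: error_ode_def)
  from half_line_derivative_nonpos[OF has_vector_derivative_minus[OF error_ode_trace[OF ode]] this t]
  show ?thesis by simp
qed

lemma error_ode_trace_gronwall:
  assumes sym: "transpose A = A" and pd: "pos_def (bar A)" and ode: "error_ode A X" and t: "t \<ge> 0"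
  obtains K where "1 + trace (X t) \<le> exp (K * t) * (1 + trace (X 0))"
proof -
  obtain K where "\<And>X. X \<in> SO3 \<Longrightarrow> trace (- (X ** skew (psi (A ** X)))) \<le> K * (1 + trace X)"
    using trace_rate_bounds[OF sym pd] by metis
  then have "trace (- (X t ** skew (psi (A ** X t)))) \<le> K * (1 + trace (X t))" if "t \<ge> 0" for t
    using ode that by (simp add: error_ode_def)
  from half_line_gronwall[OF error_ode_trace[OF ode] this t] show ?thesis by (rule that)
qed

lemma half_turns_nonempty: "half_turns \<noteq> {}"
proof -
  have "quat_rot 0 (axis 1 1) \<in> half_turns"
    unfolding half_turns_eq using half_turn_in_SO3[of "axis 1 1"] trace_quat_rot[of 0 "axis 1 1"]
    by (simp add: inner_axis_axis)
  then show ?thesis by blast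
qed

text \<open>
  The trace is Lipschitz and equals \<open>- 1\<close> on the half turns.
\<close>

lemma infdist_half_turns_lower_bound:
  obtains c where "c > 0" "\<And>X. c * (1 + trace X) \<le> infdist X half_turns"
proof -
  obtain B where B: "B > 0" "\<And>X :: real^3^3. norm (trace X) \<le> norm X * B"
    using bounded_linear.pos_bounded[OF bounded_linear_trace] by blast
  have "(1 / B) * (1 + trace X) \<le> infdist X half_turns" for X
    unfolding infdist_notempty[OF half_turns_nonempty]
  proof (rule cINF_greatest[OF half_turns_nonempty])
    fix Y assume "Y \<in> half_turns"
    then have "1 + trace X = trace (X - Y)" by (simp add: half_turns_eq trace_sub)
    also have "\<dots> \<le> dist X Y * B" using B(2)[of "X - Y"] by (simp add: dist_norm)
    finally show "(1 / B) * (1 + trace X) \<le> dist X Y" using B(1) by (simp add: field_simps)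
  qed
  then show ?thesis using B(1) by (intro that[of "1 / B"]) auto
qed

section \<open>Linear dynamics of the Rodrigues vector\<close>

lemma SO3_rodrigues_form:
  assumes X: "X \<in> SO3" "1 + trace X \<noteq> 0"
  obtains \<eta> where "\<eta>\<^sup>2 * (1 + rodrigues X \<bullet> rodrigues X) = 1" "X = quat_rot \<eta> (\<eta> *\<^sub>R rodrigues X)"
proof -
  obtain \<eta> \<epsilon> where e: "\<eta>\<^sup>2 + \<epsilon> \<bullet> \<epsilon> = 1" "X = quat_rot \<eta> \<epsilon>" using SO3_quat_rot[OF X(1)] .
  have "\<eta> \<noteq> 0" using trace_quat_rot[OF e(1)] X(2) by (auto simp: e(2))
  define z where "z = \<epsilon> /\<^sub>R \<eta>"
  have ez: "\<epsilon> = \<eta> *\<^sub>R z" using \<open>\<eta> \<noteq> 0\<close> by (simp add: z_def)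
  have n: "\<eta>\<^sup>2 * (1 + z \<bullet> z) = 1" using e(1) by (simp add: ez power2_eq_square algebra_simps)
  have Xz: "X = quat_rot \<eta> (\<eta> *\<^sub>R z)" using e(2) ez by simp
  have "rodrigues X = z" using cayley_rodrigues_quat_rot(2)[OF n] by (simp add: Xz)
  then show ?thesis using n Xz by (intro that[of \<eta>]) simp_all
qed

text \<open>
  The first equation shows that the Rodrigues vector depends differentiably on the rotation; the
  last two determine its derivative.
\<close>

lemma
  assumes X: "X \<in> SO3" "1 + trace X \<noteq> 0"
  shows rodrigues_eq_psi: "rodrigues X = (2 / (1 + trace X)) *\<^sub>R psi X"
    and cayley_rodrigues: "cayley (rodrigues X) = X"
    and rodrigues_linear_relation:
      "(mat 1 - skew (rodrigues X)) ** X = mat 1 + skew (rodrigues X)"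
      "X ** (mat 1 - skew (rodrigues X)) = mat 1 + skew (rodrigues X)"
proof -
  define z where "z = rodrigues X"
  obtain \<eta> where n: "\<eta>\<^sup>2 * (1 + z \<bullet> z) = 1" and Xz: "X = quat_rot \<eta> (\<eta> *\<^sub>R z)"
    using SO3_rodrigues_form[OF X] unfolding z_def .
  have "\<eta>\<^sup>2 + (\<eta> *\<^sub>R z) \<bullet> (\<eta> *\<^sub>R z) = 1" using n by (simp add: power2_eq_square algebra_simps)
  from trace_quat_rot[OF this] have g: "1 + trace X = 4 * \<eta>\<^sup>2" by (simp add: Xz)
  have "\<eta> \<noteq> 0" using n by auto
  then show "z = (2 / (1 + trace X)) *\<^sub>R psi X"
    unfolding g unfolding Xz psi_quat_rot by (simp add: power2_eq_square)
  show "cayley z = X" using cayley_rodrigues_quat_rot(1)[OF n] by (simp add: Xz)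
  show "(mat 1 - skew z) ** X = mat 1 + skew z" "X ** (mat 1 - skew z) = mat 1 + skew z"
    unfolding Xz by (rule quat_rot_cayley_relation[OF n])+
qed

text \<open>
  Differentiating \<open>(I - [z]) X = I + [z]\<close> gives \<open>- [z'] X - (I - [z]) X [V] = [z']\<close> with
  \<open>V = psi (A ** X)\<close>. Multiplication by \<open>I - [z]\<close> from the right and \<open>(I + X) (I - [z]) = 2 I\<close> turn this into
  \<open>2 [z'] = - (I + [z]) [V] (I - [z])\<close>, where \<open>V = \<eta>\<^sup>2 (2 bar A z + z \<times> A z)\<close> and \<open>\<eta>\<^sup>2 (1 + z \<bullet> z) = 1\<close>.
\<close>

lemma rodrigues_ode:
  assumes symA: "transpose A = A" and ode: "error_ode A X"
    and off: "\<And>t. t \<ge> 0 \<Longrightarrow> 1 + trace (X t) \<noteq> 0" and t: "t \<ge> 0"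
  shows "((\<lambda>t. rodrigues (X t)) has_vector_derivative - (bar A *v rodrigues (X t))) (at t within {0..})"
proof -
  define z where "z t = rodrigues (X t)" for t
  define V where "V = psi (A ** X t)"
  have XSO: "X t \<in> SO3" if "t \<ge> 0" for t using ode that by (simp add: error_ode_def)
  have dX: "(X has_vector_derivative - (X t ** skew V)) (at t within {0..})"
    using ode t by (simp add: error_ode_def V_def)
  have zpsi: "z t = (2 / (1 + trace (X t))) *\<^sub>R psi (X t)" if "t \<ge> 0" for t
    unfolding z_def by (rule rodrigues_eq_psi[OF XSO[OF that] off[OF that]])
  have lin: "(mat 1 - skew (z t)) ** X t = mat 1 + skew (z t)"
    "X t ** (mat 1 - skew (z t)) = mat 1 + skew (z t)" if t: "t \<ge> 0" for t
    unfolding z_def by (rule rodrigues_linear_relation[OF XSO[OF that] off[OF that]])+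
  have "z differentiable at t within {0..}"
  proof -
    have "(\<lambda>t. trace (X t)) differentiable at t within {0..}"
      by (rule differentiableI_vector[OF bounded_linear.has_vector_derivative[OF bounded_linear_trace dX]])
    moreover have "(\<lambda>t. psi (X t)) differentiable at t within {0..}"
      by (rule differentiableI_vector[OF bounded_linear.has_vector_derivative[OF bounded_linear_psi dX]])
    ultimately have "(\<lambda>t. (2 / (1 + trace (X t))) *\<^sub>R psi (X t)) differentiable at t within {0..}"
      using off[OF t] by (intro derivative_intros) auto
    then show ?thesis
      by (rule differentiable_transform_within[of _ _ _ 1]) (use t zpsi in auto)
  qed
  then obtain d where dz: "(z has_vector_derivative d) (at t within {0..})"
    by (metis vector_derivative_works)
  note ds = bounded_linear.has_vector_derivative[OF bounded_linear_skew dz]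
  have "((\<lambda>t. (mat 1 - skew (z t)) ** X t) has_vector_derivative
      (mat 1 - skew (z t)) ** (- (X t ** skew V)) + (0 - skew d) ** X t) (at t within {0..})"
    by (rule matrix_mult.has_vector_derivative[OF has_vector_derivative_diff[OF has_vector_derivative_const ds] dX])
  moreover have "((\<lambda>t. (mat 1 - skew (z t)) ** X t) has_vector_derivative skew d) (at t within {0..})"
    by (rule has_vector_derivative_transform[OF _ _ has_vector_derivative_add[OF has_vector_derivative_const ds, simplified]])
      (use t lin in auto)
  moreover have "at t within {0..} \<noteq> bot"
    using t by (rule at_within_half_line)
  ultimately have eq: "(mat 1 - skew (z t)) ** (- (X t ** skew V)) + (0 - skew d) ** X t = skew d"
    using vector_derivative_unique_within by blast
  let ?M = "mat 1 - skew (z t)"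
  have "skew d ** (mat 1 + X t) = - (?M ** X t ** skew V)"
  proof -
    have "?M ** (- (X t ** skew V)) + (0 - skew d) ** X t = - (?M ** X t ** skew V) - skew d ** X t"
      by (simp add: matrix_mult.minus_right matrix_mult.minus_left matrix_mul_assoc)
    with eq have "skew d = - (?M ** X t ** skew V) - skew d ** X t" by (rule trans[OF sym])
    then show ?thesis by (simp add: matrix_mult.add_right eq_diff_eq)
  qed
  then have "skew d ** ((mat 1 + X t) ** ?M) = - ((mat 1 + skew (z t)) ** skew V ** ?M)"
    by (simp add: lin(1)[OF t] matrix_mult.minus_left matrix_mul_assoc)
  moreover have "(mat 1 + X t) ** ?M = 2 *\<^sub>R mat 1"
    using lin(2)[OF t] by (simp add: matrix_mult.add_left scaleR_2)
  ultimately have d1: "skew (2 *\<^sub>R d) = skew (- (V + cross3 (z t) V + (z t \<bullet> V) *\<^sub>R z t))"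
    by (simp add: skew_sandwich skew_add skew_diff skew_minus skew_scaleR matrix_mult.scaleR_right)
  obtain \<eta> where n: "\<eta>\<^sup>2 * (1 + z t \<bullet> z t) = 1" and Xq: "X t = quat_rot \<eta> (\<eta> *\<^sub>R z t)"
    using SO3_rodrigues_form[OF XSO[OF t] off[OF t]] unfolding z_def .
  define W where "W = 2 *\<^sub>R (bar A *v z t) + cross3 (z t) (A *v z t)"
  have "V = \<eta>\<^sup>2 *\<^sub>R W"
    unfolding V_def Xq psi_mult_quat_rot[OF symA] W_def
    by (simp add: matrix_vector_mult.scaleR_right cross_mult_left cross_mult_right
        scaleR_add_right power2_eq_square mult_ac)
  then have "V + cross3 (z t) V + (z t \<bullet> V) *\<^sub>R z t
      = \<eta>\<^sup>2 *\<^sub>R (W + cross3 (z t) W + (z t \<bullet> W) *\<^sub>R z t)"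
    by (simp add: cross_mult_right scaleR_add_right)
  also have "\<dots> = (2 * (\<eta>\<^sup>2 * (1 + z t \<bullet> z t))) *\<^sub>R (bar A *v z t)"
    unfolding rodrigues_rhs[OF W_def] by (simp add: mult_ac)
  also have "\<dots> = 2 *\<^sub>R (bar A *v z t)" by (simp add: n)
  finally have "2 *\<^sub>R d = - (2 *\<^sub>R (bar A *v z t))"
    using d1 by (simp only: inj_eq[OF inj_skew])
  then have "2 *\<^sub>R d = 2 *\<^sub>R - (bar A *v z t)" by simp
  then have "d = - (bar A *v z t)" by (metis scaleR_cancel_left zero_neq_numeral)
  moreover have "z = (\<lambda>t. rodrigues (X t))" by (rule ext) (rule z_def)
  ultimately show ?thesis using dz by simp
qed

text \<open>
  The difference \<open>e\<close> of two solutions satisfies \<open>(e \<bullet> e)' = - 2 (e \<bullet> M e) \<le> 0\<close>, so solutions with the same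
  initial value agree.
\<close>

lemma linear_ode_solution:
  assumes pd: "pos_def M"
    and der: "\<And>t. t \<ge> 0 \<Longrightarrow> (z has_vector_derivative - (M *v z t)) (at t within {0..})" and t: "t \<ge> 0"
  shows "z t = matrix_exp ((- t) *\<^sub>R M) *v z 0"
proof -
  define w where "w t = matrix_exp (t *\<^sub>R (- M)) *v z 0" for t
  have dw: "(w has_vector_derivative - (M *v w t)) (at t within {0..})" for t
    unfolding w_def
    using bounded_linear.has_vector_derivative[OF matrix_vector_mult.bounded_linear_left
        matrix_exp_has_vector_derivative[of "- M" t], THEN has_vector_derivative_at_within, of "z 0" "{0..}"]
    by (simp add: matrix_mult.minus_left matrix_vector_mult.minus_left flip: matrix_vector_mul_assoc)
  define e where "e t = z t - w t" for t
  have de: "(e has_vector_derivative - (M *v e t)) (at t within {0..})" if "t \<ge> 0" for t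
    using has_vector_derivative_diff[OF der[OF that] dw] unfolding e_def
    by (simp add: matrix_vector_mult.diff_right)
  have "e t \<bullet> e t \<le> e 0 \<bullet> e 0"
  proof (rule half_line_derivative_nonpos[where f' = "\<lambda>t. - 2 * (e t \<bullet> (M *v e t))", OF _ _ t])
    fix t :: real assume "t \<ge> 0"
    from bounded_bilinear.has_vector_derivative[OF bounded_bilinear_inner de[OF this] de[OF this]]
    show "((\<lambda>t. e t \<bullet> e t) has_vector_derivative - 2 * (e t \<bullet> (M *v e t))) (at t within {0..})"
      by (simp add: inner_commute)
    show "- 2 * (e t \<bullet> (M *v e t)) \<le> 0" using pos_def_inner_nonneg[OF pd] by simp
  qed
  moreover have "e 0 = 0" by (simp add: e_def w_def matrix_exp_0)
  ultimately have "e t \<bullet> e t = 0" using inner_ge_zero[of "e t"] by simp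
  then have "e t = 0" by simp
  then show ?thesis by (simp add: e_def w_def)
qed

section \<open>Convergence of the attitude observer\<close>

theorem theorem1:
  fixes A :: "real^3^3" and \<omega> :: "real \<Rightarrow> real^3" and R :: "real \<Rightarrow> real^3^3"
  assumes "transpose A = A"
    and "pos_def (bar A)"
    and "attitude_kinematics \<omega> R"
  shows "(\<exists>S \<subseteq> equilibria (error_trajectories A \<omega> R). card S = 4) \<and>
         equilibria (error_trajectories A \<omega> R) =
           {mat 1} \<union> angle_axis pi ` unit_eigenvectors A \<and>
         invariant_set (error_trajectories A \<omega> R) half_turns \<and>
         non_attractive (error_trajectories A \<omega> R) half_turns \<and>
         (\<forall>X \<in> error_trajectories A \<omega> R. X 0 \<in> SO3 - half_turns \<longrightarrow>
            (\<forall>t\<ge>0. X t = cayley (matrix_exp ((- t) *\<^sub>R bar A) *v rodrigues (X 0))))"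
proof (intro conjI)
  let ?T = "error_trajectories A \<omega> R"
  note sym = assms(1) and pd = assms(2)
  note ode = error_trajectories_ode[OF assms(3)]
  show eq: "equilibria ?T = {mat 1} \<union> angle_axis pi ` unit_eigenvectors A"
    unfolding equilibria_eq[OF assms(3)] by (rule psi_mult_eq_0_iff[OF sym pd])
  show "\<exists>S \<subseteq> equilibria ?T. card S = 4"
    unfolding eq by (rule four_critical_rotations[OF sym])
  have SO: "X t \<in> SO3" if "X \<in> ?T" "t \<ge> 0" for X t
    using ode[OF that(1)] that(2) by (simp add: error_ode_def)
  have off: "0 < 1 + trace (X 0)" if "X \<in> ?T" "X 0 \<notin> half_turns" for X
    using SO[OF that(1), of 0] one_plus_trace_nonneg[of "X 0"] that(2) by (fastforce simp: half_turns_eq)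
  have grow: "1 + trace (X 0) \<le> 1 + trace (X t)" if "X \<in> ?T" "t \<ge> 0" for X t
    by (rule error_ode_trace_mono[OF sym pd ode[OF that(1)] that(2)])
  show "invariant_set ?T half_turns"
    unfolding invariant_set_def
  proof (intro ballI impI allI)
    fix X and t :: real assume X: "X \<in> ?T" "X 0 \<in> half_turns" "t \<ge> 0"
    obtain K where "1 + trace (X t) \<le> exp (K * t) * (1 + trace (X 0))"
      using error_ode_trace_gronwall[OF sym pd ode[OF X(1)] X(3)] .
    then have "1 + trace (X t) \<le> 0" using X(2) by (simp add: half_turns_eq)
    then show "X t \<in> half_turns"
      using SO[OF X(1,3)] one_plus_trace_nonneg[of "X t"] by (simp add: half_turns_eq)
  qed
  show "non_attractive ?T half_turns"
    unfolding non_attractive_def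
  proof (intro ballI impI conjI allI)
    fix X assume X: "X \<in> ?T" "X 0 \<notin> half_turns"
    show "X t \<notin> half_turns" if "t \<ge> 0" for t
      using off[OF X] grow[OF X(1) that] by (simp add: half_turns_eq)
    obtain c where c: "c > 0" "\<And>X. c * (1 + trace X) \<le> infdist X half_turns"
      using infdist_half_turns_lower_bound by blast
    show "\<not> ((\<lambda>t. infdist (X t) half_turns) \<longlongrightarrow> 0) at_top"
    proof
      assume lim: "((\<lambda>t. infdist (X t) half_turns) \<longlongrightarrow> 0) at_top"
      have "c * (1 + trace (X 0)) \<le> infdist (X t) half_turns" if "t \<ge> 0" for t
        using c grow[OF X(1) that] by (meson mult_left_mono less_imp_le order_trans)
      then have "\<forall>\<^sub>F t in at_top. c * (1 + trace (X 0)) \<le> infdist (X t) half_turns"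
        by (rule eventually_mono[OF eventually_ge_at_top[of 0]])
      then have "c * (1 + trace (X 0)) \<le> 0"
        by (rule tendsto_lowerbound[OF lim]) simp
      then show False using c(1) off[OF X] by (simp add: mult_le_0_iff)
    qed
  qed
  show "\<forall>X \<in> ?T. X 0 \<in> SO3 - half_turns \<longrightarrow>
      (\<forall>t\<ge>0. X t = cayley (matrix_exp ((- t) *\<^sub>R bar A) *v rodrigues (X 0)))"
  proof (intro ballI impI allI)
    fix X and t :: real assume X: "X \<in> ?T" "X 0 \<in> SO3 - half_turns" and t: "t \<ge> 0"
    have ne: "1 + trace (X t) \<noteq> 0" if "t \<ge> 0" for t
      using off[OF X(1)] X(2) grow[OF X(1) that] by force
    have "rodrigues (X t) = matrix_exp ((- t) *\<^sub>R bar A) *v rodrigues (X 0)"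
      by (rule linear_ode_solution[OF pd rodrigues_ode[OF sym ode[OF X(1)] ne] t])
    moreover have "cayley (rodrigues (X t)) = X t"
      by (rule cayley_rodrigues[OF SO[OF X(1) t] ne[OF t]])
    ultimately show "X t = cayley (matrix_exp ((- t) *\<^sub>R bar A) *v rodrigues (X 0))" by simp
  qed
qed

end
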